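(* Let $x,y_1,\dots,y_n$ be vectors of an inner product space $(H;(\cdot,\cdot))$ over $\mathbb{K}$. If $1<p\le 2$, $1<t\le 2$, $\frac1p+\frac1q=1$ and $\frac1t+\frac1u=1$, then $$\sum_{i=1}^n|(x,y_i)|^2\le n^{\frac1p+\frac1t-1}\|x\|^2\left[\sum_{i=1}^n\left(\sum_{j=1}^n|(y_i,y_j)|^q\right)^{\frac uq}\right]^{\frac1u}.$$
   Context: $(H;(\cdot,\cdot))$ is an inner product space over the real or complex number field $\mathbb{K}$; $\|x\|=(x,x)^{1/2}$; $n\ge 1$ is an integer. *)

theory Defs
  imports "HOL-Analysis.Analysis"
begin

text \<open>
  The scalar field: up to isometric isomorphism the only commutative real normed division
  algebras with multiplicative norm are the reals and the complex numbers, and on these the axioms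
  below force \<open>rc_cnj\<close> and \<open>rc_Re\<close> to be conjugation and real part.
\<close>

class real_or_complex = real_normed_field +
  fixes rc_cnj :: "'a \<Rightarrow> 'a"
    and rc_Re :: "'a \<Rightarrow> real"
  assumes rc_cnj_add: "rc_cnj (a + b) = rc_cnj a + rc_cnj b"
    and rc_cnj_mult: "rc_cnj (a * b) = rc_cnj a * rc_cnj b"
    and rc_mult_cnj: "a * rc_cnj a = (norm a)\<^sup>2 *\<^sub>R 1"
    and rc_add_cnj: "a + rc_cnj a = (2 * rc_Re a) *\<^sub>R 1"

instantiation real :: real_or_complex
begin

definition rc_cnj_real :: "real \<Rightarrow> real" where "rc_cnj_real a = a"
definition rc_Re_real :: "real \<Rightarrow> real" where "rc_Re_real a = a"

instance
  by standard (auto simp: rc_cnj_real_def rc_Re_real_def power2_eq_square)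

end

instantiation complex :: real_or_complex
begin

definition rc_cnj_complex :: "complex \<Rightarrow> complex" where "rc_cnj_complex = cnj"
definition rc_Re_complex :: "complex \<Rightarrow> real" where "rc_Re_complex = Re"

instance
  by standard
    (simp_all add: scaleR_conv_of_real rc_cnj_complex_def rc_Re_complex_def complex_norm_square complex_add_cnj
      del: of_real_power)

end

text \<open>No completeness is assumed. The inner product is linear in its first argument.\<close>

locale inner_product_space = vector_space scale
  for scale :: "'k::real_or_complex \<Rightarrow> 'v::ab_group_add \<Rightarrow> 'v" +
  fixes ip :: "'v \<Rightarrow> 'v \<Rightarrow> 'k"
  assumes ip_add_left: "ip (x + y) z = ip x z + ip y z"
    and ip_scale_left: "ip (scale a x) y = a * ip x y"
    and ip_commute: "ip y x = rc_cnj (ip x y)"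
    and ip_self_nonneg: "rc_Re (ip x x) \<ge> 0"
    and ip_self_eq_0: "ip x x = 0 \<Longrightarrow> x = 0"

text \<open>By Hermitian symmetry \<open>ip x x\<close> is real, so taking its real part loses nothing.\<close>

definition ip_norm :: "('v \<Rightarrow> 'v \<Rightarrow> 'k::real_or_complex) \<Rightarrow> 'v \<Rightarrow> real" where
  "ip_norm ip x = sqrt (rc_Re (ip x x))"

lemma inner_product_space_real_inner:
  "inner_product_space (scaleR :: real \<Rightarrow> 'a::real_inner \<Rightarrow> 'a) inner"
  by unfold_locales
    (auto simp: rc_cnj_real_def rc_Re_real_def inner_add_left inner_commute algebra_simps)

lemma ip_norm_real_inner: "ip_norm inner x = norm (x :: 'a::real_inner)"
  by (simp add: ip_norm_def rc_Re_real_def norm_eq_sqrt_inner)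

lemma inner_product_space_complex:
  "inner_product_space ((*) :: complex \<Rightarrow> complex \<Rightarrow> complex) (\<lambda>x y. x * cnj y)"
  by unfold_locales
    (auto simp: rc_cnj_complex_def rc_Re_complex_def algebra_simps)

end

theory Submission
  imports Defs
begin

text \<open>
  Put \<open>S = \<Sum>i. |(x, y\<^sub>i)|\<^sup>2\<close> and \<open>z = \<Sum>i. (x, y\<^sub>i) y\<^sub>i\<close>. The vector \<open>z\<close> is chosen so that \<open>(x, z) = S\<close>, and
  the Cauchy-Schwarz inequality gives \<open>S\<^sup>2 \<le> \<parallel>x\<parallel>\<^sup>2 \<parallel>z\<parallel>\<^sup>2\<close>. With \<open>c\<^sub>i = |(x, y\<^sub>i)|\<close>, expanding \<open>\<parallel>z\<parallel>\<^sup>2\<close>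
  bounds it by the quadratic form \<open>\<Sum>i j. c\<^sub>i c\<^sub>j |(y\<^sub>i, y\<^sub>j)|\<close>. Hoelder's inequality with exponents
  \<open>p, q\<close> in \<open>j\<close> and then with \<open>t, u\<close> in \<open>i\<close> separates this form into the \<open>l\<^sup>p\<close> norm of \<open>c\<close>, the \<open>l\<^sup>t\<close>
  norm of \<open>c\<close>, and the mixed norm of the Gram matrix in the conclusion. Since \<open>p, t \<le> 2\<close>, the
  comparison of means bounds the first two factors by
  \<open>n powr (1/p - 1/2) * sqrt S\<close> and \<open>n powr (1/t - 1/2) * sqrt S\<close>. Their product contributes a single
  factor \<open>S\<close>, which cancels against \<open>S\<^sup>2\<close>.
\<close>

section \<open>Inequalities for finite sums\<close>

text \<open>
  After both functions are scaled to have norm 1, Young's inequality applied termwise sums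
  to \<open>1/p + 1/q = 1\<close>.
\<close>

lemma Holder_sum:
  fixes f g :: "'a \<Rightarrow> real"
  assumes fin: "finite I" and pq: "p > 1" "q > 1" "1 / p + 1 / q = 1"
    and f: "\<And>i. i \<in> I \<Longrightarrow> f i \<ge> 0" and g: "\<And>i. i \<in> I \<Longrightarrow> g i \<ge> 0"
  shows "(\<Sum>i\<in>I. f i * g i)
    \<le> (\<Sum>i\<in>I. f i powr p) powr (1 / p) * (\<Sum>i\<in>I. g i powr q) powr (1 / q)"
proof -
  define F where "F = (\<Sum>i\<in>I. f i powr p)"
  define G where "G = (\<Sum>i\<in>I. g i powr q)"
  show ?thesis
  proof (cases "F = 0 \<or> G = 0")
    case True
    then have "\<forall>i\<in>I. f i * g i = 0"
      unfolding F_def G_def using fin by (auto simp: sum_nonneg_eq_0_iff)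
    then have "(\<Sum>i\<in>I. f i * g i) = 0" by (intro sum.neutral) auto
    then show ?thesis by simp
  next
    case False
    then have "F > 0" "G > 0"
      unfolding F_def G_def by (simp_all add: sum_nonneg order_less_le)
    define a where "a = F powr (1 / p)"
    define b where "b = G powr (1 / q)"
    have ab: "a > 0" "b > 0" and apow: "a powr p = F" and bpow: "b powr q = G"
      using \<open>F > 0\<close> \<open>G > 0\<close> pq by (simp_all add: a_def b_def powr_powr)
    have "(\<Sum>i\<in>I. (f i / a) * (g i / b))
        \<le> (\<Sum>i\<in>I. (f i / a) powr p / p + (g i / b) powr q / q)"
      using f g ab pq by (intro sum_mono Youngs_inequality) auto
    also have "\<dots> = (\<Sum>i\<in>I. f i powr p / F / p + g i powr q / G / q)"
      using f g ab by (intro sum.cong) (auto simp: powr_divide apow bpow)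
    also have "\<dots> = F / F / p + G / G / q"
      by (simp only: F_def G_def sum.distrib flip: sum_divide_distrib)
    also have "\<dots> = 1" using \<open>F > 0\<close> \<open>G > 0\<close> pq by simp
    finally have "(\<Sum>i\<in>I. f i * g i) / (a * b) \<le> 1"
      by (simp add: sum_divide_distrib)
    then have "(\<Sum>i\<in>I. f i * g i) \<le> a * b"
      using ab by (simp add: divide_le_eq)
    then show ?thesis by (simp add: a_def b_def F_def G_def)
  qed
qed

text \<open>
  For \<open>0 < p \<le> 2\<close> the \<open>p\<close>-mean is at most the quadratic mean. With \<open>A\<close> the mean of the squares,
  the weighted arithmetic-geometric inequality
  \<open>(f\<^sup>2) powr (p/2) * A powr (1 - p/2) \<le> (p/2) * f\<^sup>2 + (1 - p/2) * A\<close> is the tangent-line bound for the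
  concave map \<open>s \<mapsto> s powr (p/2)\<close> at \<open>A\<close>, and its right-hand sides sum to \<open>\<Sum> f\<^sup>2\<close>.
\<close>

lemma lp_norm_le_l2_norm:
  fixes f :: "'a \<Rightarrow> real"
  assumes fin: "finite I" and p: "0 < p" "p \<le> 2"
    and f: "\<And>i. i \<in> I \<Longrightarrow> f i \<ge> 0"
  shows "(\<Sum>i\<in>I. f i powr p) powr (1 / p)
    \<le> real (card I) powr (1 / p - 1 / 2) * sqrt (\<Sum>i\<in>I. (f i)\<^sup>2)"
proof (cases "(\<Sum>i\<in>I. (f i)\<^sup>2) = 0")
  case True
  then have "\<forall>i\<in>I. f i = 0" using fin by (simp add: sum_nonneg_eq_0_iff)
  then have "(\<Sum>i\<in>I. f i powr p) = 0" by (intro sum.neutral) auto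
  then show ?thesis using True by simp
next
  case False
  define S where "S = (\<Sum>i\<in>I. (f i)\<^sup>2)"
  define n where "n = real (card I)"
  have "S > 0" using False unfolding S_def by (simp add: sum_nonneg order_less_le)
  then have "I \<noteq> {}" by (auto simp: S_def)
  then have "n > 0" using fin by (simp add: n_def card_gt_0_iff)
  define A where "A = S / n"
  have "A > 0" using \<open>S > 0\<close> \<open>n > 0\<close> by (simp add: A_def)
  have termwise: "f i powr p * A powr (1 - p / 2) \<le> (p / 2) * (f i)\<^sup>2 + (1 - p / 2) * A"
    if "i \<in> I" for i
  proof (cases "f i = 0")
    case True
    then show ?thesis using p \<open>A > 0\<close> by simp
  next
    case False
    then have "f i > 0" using f[OF that] by simp
    then have "((f i)\<^sup>2) powr (p / 2) = f i powr p"
      by (simp add: powr_powr flip: powr_numeral)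
    then show ?thesis
      using Youngs_inequality_0[of "p / 2" "1 - p / 2" "(f i)\<^sup>2" A] p \<open>A > 0\<close> \<open>f i > 0\<close> by simp
  qed
  have "(\<Sum>i\<in>I. f i powr p) * A powr (1 - p / 2)
      \<le> (\<Sum>i\<in>I. (p / 2) * (f i)\<^sup>2 + (1 - p / 2) * A)"
    unfolding sum_distrib_right by (intro sum_mono termwise)
  also have "\<dots> = (p / 2) * S + n * ((1 - p / 2) * A)"
    unfolding S_def n_def by (simp add: sum.distrib sum_distrib_left)
  also have "\<dots> = S"
    using \<open>n > 0\<close> by (simp add: A_def field_simps)
  finally have "(\<Sum>i\<in>I. f i powr p) \<le> S / A powr (1 - p / 2)"
    using \<open>A > 0\<close> by (simp add: le_divide_eq)
  also have "\<dots> = n powr (1 - p / 2) * S powr (p / 2)"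
    using \<open>S > 0\<close> \<open>n > 0\<close> powr_add[of S "p / 2" "1 - p / 2"]
    by (simp add: A_def powr_divide field_simps)
  finally have "(\<Sum>i\<in>I. f i powr p) powr (1 / p)
      \<le> (n powr (1 - p / 2) * S powr (p / 2)) powr (1 / p)"
    using p by (intro powr_mono2) (auto simp: sum_nonneg)
  also have "\<dots> = n powr ((1 - p / 2) * (1 / p)) * S powr (1 / 2)"
    using p by (simp add: powr_mult powr_powr)
  also have "(1 - p / 2) * (1 / p) = 1 / p - 1 / 2"
    using p by (simp add: field_simps)
  finally show ?thesis
    using \<open>S > 0\<close> by (simp add: S_def n_def powr_half_sqrt)
qed

text \<open>
  For fixed \<open>i\<close>, Hoelder in \<open>j\<close> extracts the \<open>l\<^sup>p\<close> norm of \<open>c\<close>, which no longer depends on \<open>i\<close>; what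
  remains is a single sum of \<open>c\<close> against the row norms of \<open>M\<close>, to which Hoelder applies again.
\<close>

lemma quadratic_form_le_mixed_norm:
  fixes c :: "'a \<Rightarrow> real" and M :: "'a \<Rightarrow> 'a \<Rightarrow> real"
  assumes fin: "finite I"
    and p: "1 < p" "p \<le> 2" "1 / p + 1 / q = 1"
    and t: "1 < t" "t \<le> 2" "1 / t + 1 / u = 1"
    and c: "\<And>i. c i \<ge> 0" and M: "\<And>i j. M i j \<ge> 0"
  shows "(\<Sum>i\<in>I. \<Sum>j\<in>I. c i * c j * M i j)
    \<le> real (card I) powr (1 / p + 1 / t - 1) * (\<Sum>i\<in>I. (c i)\<^sup>2) *
        (\<Sum>i\<in>I. (\<Sum>j\<in>I. M i j powr q) powr (u / q)) powr (1 / u)"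
proof -
  define S where "S = (\<Sum>i\<in>I. (c i)\<^sup>2)"
  define n where "n = real (card I)"
  define P where "P = (\<Sum>j\<in>I. c j powr p) powr (1 / p)"
  define T where "T = (\<Sum>i\<in>I. c i powr t) powr (1 / t)"
  define B where "B i = (\<Sum>j\<in>I. M i j powr q) powr (1 / q)" for i
  define N where "N = (\<Sum>i\<in>I. B i powr u) powr (1 / u)"
  have conj_gt_1: "b > 1" if "1 < a" "1 / a + 1 / b = 1" for a b :: real
  proof -
    have "0 < 1 / a" "1 / a < 1" using that by simp_all
    then have "0 < 1 / b" "1 / b < 1" using that by linarith+
    then show ?thesis by (simp add: divide_less_eq split: if_splits)
  qed
  have q: "q > 1" and u: "u > 1"
    using conj_gt_1 p t by blast+
  have "S \<ge> 0" by (simp add: S_def sum_nonneg)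
  have "(\<Sum>i\<in>I. \<Sum>j\<in>I. c i * c j * M i j) = (\<Sum>i\<in>I. c i * (\<Sum>j\<in>I. c j * M i j))"
    by (simp add: sum_distrib_left mult.assoc)
  also have "\<dots> \<le> (\<Sum>i\<in>I. c i * (P * B i))"
    unfolding P_def B_def using fin p q c M
    by (intro sum_mono mult_left_mono Holder_sum) auto
  also have "\<dots> = P * (\<Sum>i\<in>I. c i * B i)"
    by (simp add: sum_distrib_left mult_ac)
  also have "\<dots> \<le> P * (T * N)"
    unfolding T_def N_def using fin t u c
    by (intro mult_left_mono Holder_sum) (auto simp: P_def B_def)
  also have "\<dots> \<le> (n powr (1 / p - 1 / 2) * sqrt S) * ((n powr (1 / t - 1 / 2) * sqrt S) * N)"
    unfolding P_def T_def n_def S_def using fin p t c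
    by (intro mult_mono lp_norm_le_l2_norm) (auto simp: N_def sum_nonneg)
  also have "\<dots> = (n powr (1 / p - 1 / 2) * n powr (1 / t - 1 / 2)) * (sqrt S * sqrt S) * N"
    by (simp only: mult_ac)
  also have "\<dots> = n powr (1 / p + 1 / t - 1) * S * N"
    using \<open>S \<ge> 0\<close> by (simp flip: powr_add)
  also have "N = (\<Sum>i\<in>I. (\<Sum>j\<in>I. M i j powr q) powr (u / q)) powr (1 / u)"
    by (simp add: N_def B_def powr_powr)
  finally show ?thesis by (simp add: n_def S_def)
qed

section \<open>Scalars\<close>

lemma rc_cnj_0: "rc_cnj (0 :: 'k::real_or_complex) = 0"
  using rc_cnj_add[of 0 "0 :: 'k"] by simp

lemma rc_cnj_minus: "rc_cnj (- a :: 'k::real_or_complex) = - rc_cnj a"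
  using rc_cnj_add[of a "- a"] by (simp add: rc_cnj_0 eq_neg_iff_add_eq_0 add.commute)

lemma rc_cnj_of_real: "rc_cnj (of_real r :: 'k::real_or_complex) = of_real r"
proof (cases "r = 0")
  case False
  have "of_real r * rc_cnj (of_real r :: 'k) = of_real r * of_real r"
    using rc_mult_cnj[of "of_real r :: 'k"] by (simp add: scaleR_conv_of_real power2_eq_square flip: of_real_mult)
  then show ?thesis using False by simp
qed (simp add: rc_cnj_0)

lemma norm_rc_cnj: "norm (rc_cnj (a :: 'k::real_or_complex)) = norm a"
proof (cases "a = 0")
  case False
  have "norm a * norm (rc_cnj a) = norm a * norm a"
    using arg_cong[OF rc_mult_cnj[of a], of norm] by (simp add: norm_mult power2_eq_square)
  then show ?thesis using False by simp
qed (simp add: rc_cnj_0)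

lemma rc_Re_of_real: "rc_Re (of_real r :: 'k::real_or_complex) = r"
proof -
  have "(of_real (2 * r) :: 'k) = of_real (2 * rc_Re (of_real r :: 'k))"
    using rc_add_cnj[of "of_real r :: 'k"] by (simp add: rc_cnj_of_real scaleR_conv_of_real)
  then show ?thesis unfolding of_real_eq_iff by simp
qed

section \<open>Inner products\<close>

context inner_product_space
begin

lemma ip_zero_left: "ip 0 z = 0"
  using ip_add_left[of 0 0 z] by simp

lemma ip_zero_right: "ip x 0 = 0"
  using ip_commute[of x 0] by (simp add: ip_zero_left rc_cnj_0)

lemma ip_add_right: "ip x (y + z) = ip x y + ip x z"
  by (metis ip_add_left ip_commute rc_cnj_add)

lemma ip_scale_right: "ip x (scale a y) = rc_cnj a * ip x y"
  by (metis ip_scale_left ip_commute rc_cnj_mult)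

lemma ip_sum_left: "ip (\<Sum>i\<in>I. f i) z = (\<Sum>i\<in>I. ip (f i) z)"
  by (induction I rule: infinite_finite_induct) (auto simp: ip_zero_left ip_add_left)

lemma ip_sum_right: "ip z (\<Sum>i\<in>I. f i) = (\<Sum>i\<in>I. ip z (f i))"
  by (induction I rule: infinite_finite_induct) (auto simp: ip_zero_right ip_add_right)

lemma ip_norm_sq: "(ip_norm ip x)\<^sup>2 = rc_Re (ip x x)"
  by (simp add: ip_norm_def ip_self_nonneg)

lemma ip_self: "ip x x = of_real ((ip_norm ip x)\<^sup>2)"
proof -
  have "2 * ip x x = 2 * of_real (rc_Re (ip x x))"
    using rc_add_cnj[of "ip x x"] ip_commute[of x x] by (simp add: scaleR_conv_of_real)
  then show ?thesis by (simp add: ip_norm_sq)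
qed

text \<open>
  For \<open>z \<noteq> 0\<close> the vector \<open>w = \<parallel>z\<parallel>\<^sup>2 x - (x, z) z\<close> is a multiple of the component of \<open>x\<close> orthogonal to
  \<open>z\<close>, and \<open>\<parallel>w\<parallel>\<^sup>2 = \<parallel>z\<parallel>\<^sup>2 (\<parallel>x\<parallel>\<^sup>2 \<parallel>z\<parallel>\<^sup>2 - |(x, z)|\<^sup>2)\<close>.
\<close>

lemma Cauchy_Schwarz: "(norm (ip x z))\<^sup>2 \<le> (ip_norm ip x)\<^sup>2 * (ip_norm ip z)\<^sup>2"
proof (cases "z = 0")
  case True
  then show ?thesis by (simp add: ip_zero_right)
next
  case False
  define X where "X = (ip_norm ip x)\<^sup>2"
  define Z where "Z = (ip_norm ip z)\<^sup>2"
  define a where "a = ip x z"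
  define w where "w = scale (of_real Z) x + scale (- a) z"
  have "Z \<noteq> 0"
    using False ip_self_eq_0[of z] ip_self[of z] by (auto simp: Z_def)
  then have "Z > 0" by (simp add: Z_def)
  have a_cnj: "a * rc_cnj a = of_real ((norm a)\<^sup>2)"
    by (simp add: rc_mult_cnj scaleR_conv_of_real)
  have "ip x x = of_real X" "ip z z = of_real Z" "ip z x = rc_cnj a"
    using ip_commute[of z x] by (auto simp: X_def Z_def a_def ip_self simp del: of_real_power)
  then have "ip w w = of_real (Z * Z * X) - of_real Z * (a * rc_cnj a)
      - of_real Z * (a * rc_cnj a) + of_real Z * (a * rc_cnj a)"
    by (simp add: w_def ip_add_left ip_add_right ip_scale_left ip_scale_right rc_cnj_of_real
        rc_cnj_minus algebra_simps del: scale_minus_left flip: a_def)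
  also have "\<dots> = of_real (Z * (X * Z - (norm a)\<^sup>2))"
    unfolding a_cnj by (simp add: algebra_simps)
  finally have "rc_Re (ip w w) = Z * (X * Z - (norm a)\<^sup>2)"
    by (simp only: rc_Re_of_real)
  then have "0 \<le> Z * (X * Z - (norm a)\<^sup>2)"
    using ip_self_nonneg[of w] by simp
  then show ?thesis
    using \<open>Z > 0\<close> by (simp add: zero_le_mult_iff X_def Z_def a_def)
qed

lemma ip_norm_sq_lincomb_le:
  "(ip_norm ip (\<Sum>i\<in>I. scale (a i) (y i)))\<^sup>2
    \<le> (\<Sum>i\<in>I. \<Sum>j\<in>I. norm (a i) * norm (a j) * norm (ip (y i) (y j)))"
proof -
  let ?z = "\<Sum>i\<in>I. scale (a i) (y i)"
  have "(ip_norm ip ?z)\<^sup>2 = norm (ip ?z ?z)"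
    unfolding ip_self[of ?z] norm_of_real by simp
  also have "ip ?z ?z = (\<Sum>i\<in>I. \<Sum>j\<in>I. a i * (rc_cnj (a j) * ip (y i) (y j)))"
    unfolding ip_sum_left[of _ I] ip_scale_left
    by (simp add: ip_sum_right ip_scale_right sum_distrib_left)
  also have "norm \<dots> \<le> (\<Sum>i\<in>I. \<Sum>j\<in>I. norm (a i * (rc_cnj (a j) * ip (y i) (y j))))"
    by (intro order.trans[OF norm_sum] sum_mono norm_sum)
  finally show ?thesis by (simp add: norm_mult norm_rc_cnj mult.assoc)
qed

text \<open>
  This is duality: testing \<open>x\<close> against \<open>z = \<Sum>i. (x, y\<^sub>i) y\<^sub>i\<close> shows that any bound
  \<open>\<parallel>z\<parallel>\<^sup>2 \<le> K * \<Sum>i. |(x, y\<^sub>i)|\<^sup>2\<close> yields a Bessel-type inequality with the same constant \<open>K\<close>.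
\<close>

lemma Bessel_type_from_lincomb:
  assumes "(ip_norm ip (\<Sum>i\<in>I. scale (ip x (y i)) (y i)))\<^sup>2
      \<le> K * (\<Sum>i\<in>I. (norm (ip x (y i)))\<^sup>2)"
    and "K \<ge> 0"
  shows "(\<Sum>i\<in>I. (norm (ip x (y i)))\<^sup>2) \<le> (ip_norm ip x)\<^sup>2 * K"
proof -
  define S where "S = (\<Sum>i\<in>I. (norm (ip x (y i)))\<^sup>2)"
  let ?z = "\<Sum>i\<in>I. scale (ip x (y i)) (y i)"
  have "S \<ge> 0" by (simp add: S_def sum_nonneg)
  have "ip x ?z = of_real S"
    by (simp add: ip_sum_right ip_scale_right S_def rc_mult_cnj scaleR_conv_of_real mult.commute)
  then have "S\<^sup>2 \<le> (ip_norm ip x)\<^sup>2 * (ip_norm ip ?z)\<^sup>2"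
    using Cauchy_Schwarz[of x ?z] by simp
  also have "\<dots> \<le> (ip_norm ip x)\<^sup>2 * (K * S)"
    using assms(1) by (intro mult_left_mono) (auto simp: S_def)
  finally have "S * S \<le> ((ip_norm ip x)\<^sup>2 * K) * S"
    by (simp add: power2_eq_square mult_ac)
  then have "S \<le> (ip_norm ip x)\<^sup>2 * K"
    using \<open>S \<ge> 0\<close> assms(2) by (cases "S = 0") auto
  then show ?thesis by (simp add: S_def)
qed

end

section \<open>The inequality\<close>

theorem mainTheorem2:
  fixes scale :: "'k::real_or_complex \<Rightarrow> 'v::ab_group_add \<Rightarrow> 'v"
    and ip :: "'v \<Rightarrow> 'v \<Rightarrow> 'k"
    and x :: 'v and y :: "nat \<Rightarrow> 'v" and n :: nat
    and p q t u :: real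
  assumes "inner_product_space scale ip"
    and "n \<ge> 1"
    and "1 < p" and "p \<le> 2"
    and "1 < t" and "t \<le> 2"
    and "1 / p + 1 / q = 1"
    and "1 / t + 1 / u = 1"
  shows "(\<Sum>i=1..n. (norm (ip x (y i)))\<^sup>2)
    \<le> real n powr (1 / p + 1 / t - 1) * (ip_norm ip x)\<^sup>2 *
        (\<Sum>i=1..n. (\<Sum>j=1..n. norm (ip (y i) (y j)) powr q) powr (u / q)) powr (1 / u)"
proof -
  interpret inner_product_space scale ip by fact
  let ?N = "(\<Sum>i=1..n. (\<Sum>j=1..n. norm (ip (y i) (y j)) powr q) powr (u / q)) powr (1 / u)"
  let ?K = "real n powr (1 / p + 1 / t - 1) * ?N"
  have "(ip_norm ip (\<Sum>i=1..n. scale (ip x (y i)) (y i)))\<^sup>2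
      \<le> (\<Sum>i=1..n. \<Sum>j=1..n. norm (ip x (y i)) * norm (ip x (y j)) * norm (ip (y i) (y j)))"
    by (rule ip_norm_sq_lincomb_le)
  also have "\<dots> \<le> real (card {1..n}) powr (1 / p + 1 / t - 1) *
      (\<Sum>i=1..n. (norm (ip x (y i)))\<^sup>2) * ?N"
    using assms by (intro quadratic_form_le_mixed_norm) auto
  also have "\<dots> = ?K * (\<Sum>i=1..n. (norm (ip x (y i)))\<^sup>2)"
    by (simp add: mult_ac)
  finally have "(\<Sum>i=1..n. (norm (ip x (y i)))\<^sup>2) \<le> (ip_norm ip x)\<^sup>2 * ?K"
    by (rule Bessel_type_from_lincomb) simp
  then show ?thesis by (simp add: mult_ac)
qed

end
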